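(* For every hypersequent $G$: if the inequality $[\![G]\!]\geq 0$ is derivable in equational logic from the axioms of Riesz spaces (equivalently, holds in every Riesz space under every assignment of the variables), then $G$ is derivable in the hypersequent calculus $\mathbf{HR}$.
   Context: Terms. Fix a countable set of variables $x,y,z,\dots$. Terms (in negation normal form) are generated by $A ::= x \mid \overline{x} \mid 0 \mid A+A \mid rA \mid A\sqcup A \mid A\sqcap A$, where $x$ is a variable, $\overline{x}$ is the corresponding negated variable, and $r\in\mathbb{R}_{>0}$. The negation $\overline{A}$ of a term is defined by $\overline{x}$ (for $x$), $\overline{\overline{x}}=x$, $\overline{0}=0$, $\overline{A+B}=\overline{A}+\overline{B}$, $\overline{rA}=r\overline{A}$, $\overline{A\sqcup B}=\overline{A}\sqcap\overline{B}$, $\overline{A\sqcap B}=\overline{A}\sqcup\overline{B}$. Terms are interpreted in Riesz spaces (vector lattices) reading $\overline{x}$ as $-x$, $rA$ as scalar multiplication, and $\sqcup,\sqcap$ as join and meet. A weighted term is $r.A$ with $r\in\mathbb{R}_{>0}$; a sequent $\vdash\Gamma$ has $\Gamma$ a finite (possibly empty) multiset of weighted terms; a hypersequent is a nonempty finite multiset of sequents, written $\vdash\Gamma_1\mid\cdots\mid\vdash\Gamma_n$, and $G\mid\vdash\Gamma$ denotes the hypersequent $G$ with the sequent $\vdash\Gamma$ added. For a finite (possibly empty) sequence $\vec r=(r_1,\dots,r_n)$ of strictly positive reals, $\vec r.A$ is the multiset $r_1.A,\dots,r_n.A$, $\sum\vec r=r_1+\dots+r_n$, and $s\vec r=(sr_1,\dots,sr_n)$;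 for $s>0$, $s.\Gamma$ multiplies every weight in $\Gamma$ by $s$. Interpretation: $[\![r.A]\!]=rA$; $[\![\vdash r_1.A_1,\dots,r_n.A_n]\!]=r_1A_1+\dots+r_nA_n$ (empty sum $=0$); $[\![\vdash\Gamma_1\mid\dots\mid\vdash\Gamma_n]\!]=[\![\vdash\Gamma_1]\!]\sqcup\dots\sqcup[\![\vdash\Gamma_n]\!]$. The calculus $\mathbf{HR}$ has the rules (vectors are finite sequences of strictly positive reals): INIT: the hypersequent $\vdash$ (one empty sequent) with no premises. W: from $G$ infer $G\mid\vdash\Gamma$. C: from $G\mid\vdash\Gamma\mid\vdash\Gamma$ infer $G\mid\vdash\Gamma$. S: from $G\mid\vdash\Gamma_1,\Gamma_2$ infer $G\mid\vdash\Gamma_1\mid\vdash\Gamma_2$. M: from $G\mid\vdash\Gamma_1$ and $G\mid\vdash\Gamma_2$ infer $G\mid\vdash\Gamma_1,\Gamma_2$. T: for $r>0$, from $G\mid\vdash r.\Gamma$ infer $G\mid\vdash\Gamma$. ID: if $\sum\vec r=\sum\vec s$, from $G\mid\vdash\Gamma$ infer $G\mid\vdash\Gamma,\vec r.x,\vec s.\overline{x}$ ($x$ a variable). 0: from $G\mid\vdash\Gamma$ infer $G\mid\vdash\Gamma,\vec r.0$. $+$: from $G\mid\vdash\Gamma,\vec r.A,\vec r.B$ infer $G\mid\vdash\Gamma,\vec r.(A+B)$. $\times$: from $G\mid\vdash\Gamma,(s\vec r).A$ infer $G\mid\vdash\Gamma,\vec r.(sA)$. $\sqcup$: from $G\mid\vdash\Gamma,\vec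 r.A\mid\vdash\Gamma,\vec r.B$ infer $G\mid\vdash\Gamma,\vec r.(A\sqcup B)$. $\sqcap$: from $G\mid\vdash\Gamma,\vec r.A$ and $G\mid\vdash\Gamma,\vec r.B$ infer $G\mid\vdash\Gamma,\vec r.(A\sqcap B)$. CAN: if $\sum\vec r=\sum\vec s$, from $G\mid\vdash\Gamma,\vec s.A,\vec r.\overline{A}$ infer $G\mid\vdash\Gamma$. A derivation is a finite tree of rule instances whose leaves are INIT. *)

theory Defs
  imports Complex_Main "HOL-Library.Multiset"
begin

section \<open>Riesz terms and equational logic\<close>

text \<open>Terms over the full signature of Riesz spaces: real vector space operations and lattice
  operations. The opposite of \<open>A\<close> is \<open>RScale (-1) A\<close>.\<close>

datatype rterm =
    RVar nat
  | RZero
  | RAdd rterm rterm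
  | RScale real rterm
  | RSup rterm rterm
  | RInf rterm rterm

text \<open>Derivability in equational logic from the axioms of Riesz spaces. The axioms are stated as
  schemes, so the substitution rule is built in. The inequality \<open>A \<le> B\<close> of the axioms (and of
  \<open>riesz_le\<close> below) is the equation \<open>A \<sqinter> B = A\<close>.\<close>

inductive riesz_eq :: "rterm \<Rightarrow> rterm \<Rightarrow> bool" (infix "\<approx>\<^sub>R" 50) where
  req_refl: "A \<approx>\<^sub>R A"
| req_sym: "A \<approx>\<^sub>R B \<Longrightarrow> B \<approx>\<^sub>R A"
| req_trans: "A \<approx>\<^sub>R B \<Longrightarrow> B \<approx>\<^sub>R C \<Longrightarrow> A \<approx>\<^sub>R C"
| req_cong_add: "A \<approx>\<^sub>R A' \<Longrightarrow> B \<approx>\<^sub>R B' \<Longrightarrow> RAdd A B \<approx>\<^sub>R RAdd A' B'"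
| req_cong_scale: "A \<approx>\<^sub>R A' \<Longrightarrow> RScale r A \<approx>\<^sub>R RScale r A'"
| req_cong_sup: "A \<approx>\<^sub>R A' \<Longrightarrow> B \<approx>\<^sub>R B' \<Longrightarrow> RSup A B \<approx>\<^sub>R RSup A' B'"
| req_cong_inf: "A \<approx>\<^sub>R A' \<Longrightarrow> B \<approx>\<^sub>R B' \<Longrightarrow> RInf A B \<approx>\<^sub>R RInf A' B'"
\<comment> \<open>real vector space\<close>
| req_add_assoc: "RAdd A (RAdd B C) \<approx>\<^sub>R RAdd (RAdd A B) C"
| req_add_comm: "RAdd A B \<approx>\<^sub>R RAdd B A"
| req_add_zero: "RAdd A RZero \<approx>\<^sub>R A"
| req_add_minus: "RAdd A (RScale (-1) A) \<approx>\<^sub>R RZero"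
| req_scale_scale: "RScale r (RScale s A) \<approx>\<^sub>R RScale (r * s) A"
| req_scale_one: "RScale 1 A \<approx>\<^sub>R A"
| req_scale_add_right: "RScale r (RAdd A B) \<approx>\<^sub>R RAdd (RScale r A) (RScale r B)"
| req_scale_add_left: "RScale (r + s) A \<approx>\<^sub>R RAdd (RScale r A) (RScale s A)"
\<comment> \<open>lattice\<close>
| req_sup_assoc: "RSup A (RSup B C) \<approx>\<^sub>R RSup (RSup A B) C"
| req_sup_comm: "RSup A B \<approx>\<^sub>R RSup B A"
| req_sup_absorb: "RSup A (RInf A B) \<approx>\<^sub>R A"
| req_inf_assoc: "RInf A (RInf B C) \<approx>\<^sub>R RInf (RInf A B) C"
| req_inf_comm: "RInf A B \<approx>\<^sub>R RInf B A"
| req_inf_absorb: "RInf A (RSup A B) \<approx>\<^sub>R A"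
\<comment> \<open>compatibility: \<open>(A \<sqinter> B) + C \<le> B + C\<close>, and \<open>r(A \<sqinter> B) \<le> rB\<close> for \<open>r \<ge> 0\<close>\<close>
| req_add_mono: "RInf (RAdd (RInf A B) C) (RAdd B C) \<approx>\<^sub>R RAdd (RInf A B) C"
| req_scale_mono: "r \<ge> 0 \<Longrightarrow> RInf (RScale r (RInf A B)) (RScale r B) \<approx>\<^sub>R RScale r (RInf A B)"

definition riesz_le :: "rterm \<Rightarrow> rterm \<Rightarrow> bool" (infix "\<le>\<^sub>R" 50) where
  "A \<le>\<^sub>R B \<longleftrightarrow> RInf A B \<approx>\<^sub>R A"


section \<open>Terms in negation normal form, sequents and hypersequents\<close>

typedef preal = "{r :: real. r > 0}"
  morphisms real_of_preal Abs_preal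
  by (rule exI[of _ 1]) simp

setup_lifting type_definition_preal

instantiation preal :: comm_monoid_mult
begin
lift_definition one_preal :: preal is 1 by simp
lift_definition times_preal :: "preal \<Rightarrow> preal \<Rightarrow> preal" is "(*)" by simp
instance by standard (transfer; simp)+
end

datatype nnf =
    Var nat
  | NVar nat
  | Zero
  | Add nnf nnf
  | Scale preal nnf
  | Sup nnf nnf
  | Inf nnf nnf

primrec neg :: "nnf \<Rightarrow> nnf" where
  "neg (Var x) = NVar x"
| "neg (NVar x) = Var x"
| "neg Zero = Zero"
| "neg (Add A B) = Add (neg A) (neg B)"
| "neg (Scale r A) = Scale r (neg A)"
| "neg (Sup A B) = Inf (neg A) (neg B)"
| "neg (Inf A B) = Sup (neg A) (neg B)"

type_synonym wterm = "preal \<times> nnf"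
type_synonym sequent = "wterm multiset"

text \<open>A hypersequent is a \<^emph>\<open>nonempty\<close> multiset of sequents; the type also contains the empty
  multiset, which serves as the empty context \<open>G\<close> in \<open>G | \<turnstile> \<Gamma>\<close>, i.e. \<^term>\<open>add_mset \<Gamma> G\<close>.\<close>

type_synonym hypersequent = "sequent multiset"

primrec nnf_interp :: "nnf \<Rightarrow> rterm" where
  "nnf_interp (Var x) = RVar x"
| "nnf_interp (NVar x) = RScale (-1) (RVar x)"
| "nnf_interp Zero = RZero"
| "nnf_interp (Add A B) = RAdd (nnf_interp A) (nnf_interp B)"
| "nnf_interp (Scale r A) = RScale (real_of_preal r) (nnf_interp A)"
| "nnf_interp (Sup A B) = RSup (nnf_interp A) (nnf_interp B)"
| "nnf_interp (Inf A B) = RInf (nnf_interp A) (nnf_interp B)"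

definition wterm_interp :: "wterm \<Rightarrow> rterm" where
  "wterm_interp w = RScale (real_of_preal (fst w)) (nnf_interp (snd w))"

fun rsum :: "rterm list \<Rightarrow> rterm" where
  "rsum [] = RZero"
| "rsum [A] = A"
| "rsum (A # B # As) = RAdd A (rsum (B # As))"

text \<open>The value at the empty list is irrelevant.\<close>

fun rsup :: "rterm list \<Rightarrow> rterm" where
  "rsup [] = RZero"
| "rsup [A] = A"
| "rsup (A # B # As) = RSup A (rsup (B # As))"

text \<open>Reading a multiset as a term requires an enumeration of it; the choice does not matter up to
  provable equality, see \<open>seq_interp_eq\<close> and \<open>hseq_interp_eq\<close>.\<close>

definition seq_interp :: "sequent \<Rightarrow> rterm" where
  "seq_interp \<Gamma> = rsum (map wterm_interp (SOME ws. mset ws = \<Gamma>))"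

definition hseq_interp :: "hypersequent \<Rightarrow> rterm" where
  "hseq_interp G = rsup (map seq_interp (SOME \<Gamma>s. mset \<Gamma>s = G))"

lemma rsum_Cons: "rsum (A # As) \<approx>\<^sub>R RAdd A (rsum As)"
  by (cases As) (auto intro: riesz_eq.intros)

lemma rsup_Cons: "As \<noteq> [] \<Longrightarrow> rsup (A # As) = RSup A (rsup As)"
  by (cases As) auto

lemma rsum_middle: "rsum (As @ A # Bs) \<approx>\<^sub>R RAdd A (rsum (As @ Bs))"
proof (induction As)
  case Nil
  show ?case by (simp add: rsum_Cons)
next
  case (Cons C As)
  have "rsum (C # As @ A # Bs) \<approx>\<^sub>R RAdd C (RAdd A (rsum (As @ Bs)))"
    by (meson Cons.IH req_cong_add req_refl req_trans rsum_Cons)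
  moreover have "RAdd C (RAdd A (rsum (As @ Bs))) \<approx>\<^sub>R RAdd A (RAdd C (rsum (As @ Bs)))"
    by (meson req_add_assoc req_add_comm req_cong_add req_refl req_sym
        req_trans)
  moreover have "RAdd A (RAdd C (rsum (As @ Bs))) \<approx>\<^sub>R RAdd A (rsum (C # As @ Bs))"
    by (meson req_cong_add req_refl req_sym rsum_Cons)
  ultimately show ?case
    by (metis append_Cons req_trans)
qed

lemma rsup_middle: "As @ Bs \<noteq> [] \<Longrightarrow> rsup (As @ A # Bs) \<approx>\<^sub>R RSup A (rsup (As @ Bs))"
proof (induction As)
  case Nil
  then show ?case by (simp add: rsup_Cons req_refl)
next
  case (Cons C As)
  show ?case
  proof (cases "As @ Bs = []")
    case True
    then show ?thesis by (simp add: req_sup_comm)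
  next
    case False
    have "rsup (C # As @ A # Bs) \<approx>\<^sub>R RSup C (RSup A (rsup (As @ Bs)))"
      using Cons.IH[OF False] by (simp add: rsup_Cons req_cong_sup req_refl)
    moreover have "RSup C (RSup A (rsup (As @ Bs))) \<approx>\<^sub>R RSup A (RSup C (rsup (As @ Bs)))"
      by (meson req_sup_assoc req_sup_comm req_cong_sup req_refl req_sym
          req_trans)
    ultimately show ?thesis
      using False by (simp add: rsup_Cons) (meson req_trans)
  qed
qed

lemma rsum_cong: "list_all2 (\<approx>\<^sub>R) As Bs \<Longrightarrow> rsum As \<approx>\<^sub>R rsum Bs"
  by (induction rule: list_all2_induct)
    (auto intro: req_refl, meson req_cong_add req_sym req_trans rsum_Cons)

lemma rsup_cong: "list_all2 (\<approx>\<^sub>R) As Bs \<Longrightarrow> rsup As \<approx>\<^sub>R rsup Bs"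
proof (induction rule: list_all2_induct)
  case Nil
  show ?case by (simp add: req_refl)
next
  case (Cons A As B Bs)
  then show ?case
    by (cases "As = []"; cases "Bs = []") (auto simp: rsup_Cons intro: req_cong_sup)
qed

lemma rsum_perm: "mset As = mset Bs \<Longrightarrow> rsum As \<approx>\<^sub>R rsum Bs"
proof (induction As arbitrary: Bs)
  case Nil
  then show ?case by (simp add: req_refl)
next
  case (Cons A As)
  have "A \<in> set Bs"
    using Cons.prems by (metis list.set_intros(1) mset_eq_setD)
  then obtain Bs1 Bs2 where Bs: "Bs = Bs1 @ A # Bs2"
    by (meson split_list)
  have "rsum As \<approx>\<^sub>R rsum (Bs1 @ Bs2)"
    using Cons.prems by (intro Cons.IH) (simp add: Bs)
  then show ?case unfolding Bs
    by (meson req_cong_add req_refl req_sym req_trans rsum_Cons rsum_middle)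
qed

lemma rsup_perm: "mset As = mset Bs \<Longrightarrow> rsup As \<approx>\<^sub>R rsup Bs"
proof (induction As arbitrary: Bs)
  case Nil
  then show ?case by (simp add: req_refl)
next
  case (Cons A As)
  have "A \<in> set Bs"
    using Cons.prems by (metis list.set_intros(1) mset_eq_setD)
  then obtain Bs1 Bs2 where Bs: "Bs = Bs1 @ A # Bs2"
    by (meson split_list)
  have eq: "mset As = mset (Bs1 @ Bs2)"
    using Cons.prems by (simp add: Bs)
  show ?case
  proof (cases "As = []")
    case True
    then show ?thesis using eq by (simp add: Bs req_refl)
  next
    case False
    then have "Bs1 @ Bs2 \<noteq> []" using eq by auto
    from rsup_middle[OF this, of A] Cons.IH[OF eq] False show ?thesis
      unfolding Bs
      by (metis req_cong_sup req_refl req_sym req_trans rsup_Cons)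
  qed
qed

lemma seq_interp_eq: "seq_interp (mset ws) \<approx>\<^sub>R rsum (map wterm_interp ws)"
proof -
  have "mset (SOME vs. mset vs = mset ws) = mset ws"
    by (rule someI) (rule refl)
  then show ?thesis
    unfolding seq_interp_def by (intro rsum_perm) simp
qed

lemma hseq_interp_eq:
  "hseq_interp (mset (map mset wss)) \<approx>\<^sub>R rsup (map (\<lambda>ws. rsum (map wterm_interp ws)) wss)"
proof -
  have "mset (SOME \<Gamma>s. mset \<Gamma>s = mset (map mset wss)) = mset (map mset wss)"
    by (rule someI) (rule refl)
  then have "hseq_interp (mset (map mset wss)) \<approx>\<^sub>R rsup (map seq_interp (map mset wss))"
    unfolding hseq_interp_def by (intro rsup_perm) (metis mset_map)
  moreover have "rsup (map seq_interp (map mset wss))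
      \<approx>\<^sub>R rsup (map (\<lambda>ws. rsum (map wterm_interp ws)) wss)"
    by (rule rsup_cong) (simp add: list_all2_conv_all_nth seq_interp_eq)
  ultimately show ?thesis by (rule req_trans)
qed


section \<open>The hypersequent calculus HR\<close>

definition vec :: "preal list \<Rightarrow> nnf \<Rightarrow> sequent" where
  "vec rs A = mset (map (\<lambda>r. (r, A)) rs)"

definition vec_sum :: "preal list \<Rightarrow> real" where
  "vec_sum rs = sum_list (map real_of_preal rs)"

definition scale_seq :: "preal \<Rightarrow> sequent \<Rightarrow> sequent" where
  "scale_seq s \<Gamma> = image_mset (\<lambda>(r, A). (s * r, A)) \<Gamma>"

inductive HR :: "hypersequent \<Rightarrow> bool" where
  HR_INIT: "HR {#{#}#}"
| HR_W: "HR G \<Longrightarrow> HR (add_mset \<Gamma> G)"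
| HR_C: "HR (add_mset \<Gamma> (add_mset \<Gamma> G)) \<Longrightarrow> HR (add_mset \<Gamma> G)"
| HR_S: "HR (add_mset (\<Gamma>1 + \<Gamma>2) G) \<Longrightarrow> HR (add_mset \<Gamma>1 (add_mset \<Gamma>2 G))"
| HR_M: "HR (add_mset \<Gamma>1 G) \<Longrightarrow> HR (add_mset \<Gamma>2 G) \<Longrightarrow> HR (add_mset (\<Gamma>1 + \<Gamma>2) G)"
| HR_T: "HR (add_mset (scale_seq r \<Gamma>) G) \<Longrightarrow> HR (add_mset \<Gamma> G)"
| HR_ID: "vec_sum rs = vec_sum ss \<Longrightarrow> HR (add_mset \<Gamma> G)
    \<Longrightarrow> HR (add_mset (\<Gamma> + vec rs (Var x) + vec ss (NVar x)) G)"
| HR_ZERO: "HR (add_mset \<Gamma> G) \<Longrightarrow> HR (add_mset (\<Gamma> + vec rs Zero) G)"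
| HR_PLUS: "HR (add_mset (\<Gamma> + vec rs A + vec rs B) G)
    \<Longrightarrow> HR (add_mset (\<Gamma> + vec rs (Add A B)) G)"
| HR_TIMES: "HR (add_mset (\<Gamma> + vec (map ((*) s) rs) A) G)
    \<Longrightarrow> HR (add_mset (\<Gamma> + vec rs (Scale s A)) G)"
| HR_SUP: "HR (add_mset (\<Gamma> + vec rs A) (add_mset (\<Gamma> + vec rs B) G))
    \<Longrightarrow> HR (add_mset (\<Gamma> + vec rs (Sup A B)) G)"
| HR_INF: "HR (add_mset (\<Gamma> + vec rs A) G) \<Longrightarrow> HR (add_mset (\<Gamma> + vec rs B) G)
    \<Longrightarrow> HR (add_mset (\<Gamma> + vec rs (Inf A B)) G)"
| HR_CAN: "vec_sum rs = vec_sum ss \<Longrightarrow> HR (add_mset (\<Gamma> + vec ss A + vec rs (neg A)) G)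
    \<Longrightarrow> HR (add_mset \<Gamma> G)"

end

theory Submission
  imports Defs
begin

text \<open>
  An inequality provable from the Riesz space axioms holds in the reals, so \<open>G\<close> has a nonnegative
  sequent under every real valuation. Over the reals every logical rule is invertible, which reduces
  \<open>G\<close> to hypersequents of variables and negated variables, that is, to finite families of linear
  forms that are never simultaneously negative. Fourier-Motzkin elimination of a variable is a
  derivation read bottom-up: a positive combination \<open>s.\<Gamma>, t.\<Delta>\<close> in which the variable cancels is
  obtained from \<open>\<Gamma>\<close> and \<open>\<Delta>\<close> by C, T and S, and the cancelling occurrences are removed by ID. Once
  all variables are gone, only INIT is left. The rules M and CAN are not needed.
\<close>

section \<open>Real semantics\<close>

primrec rterm_val :: "(nat \<Rightarrow> real) \<Rightarrow> rterm \<Rightarrow> real" where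
  "rterm_val v (RVar x) = v x"
| "rterm_val v RZero = 0"
| "rterm_val v (RAdd A B) = rterm_val v A + rterm_val v B"
| "rterm_val v (RScale r A) = r * rterm_val v A"
| "rterm_val v (RSup A B) = max (rterm_val v A) (rterm_val v B)"
| "rterm_val v (RInf A B) = min (rterm_val v A) (rterm_val v B)"

lemma riesz_eq_sound: "A \<approx>\<^sub>R B \<Longrightarrow> rterm_val v A = rterm_val v B"
proof (induction rule: riesz_eq.induct)
  case (req_scale_mono r A B)
  then show ?case by (simp add: min_def mult_left_mono)
qed (auto simp: algebra_simps)

definition nnf_val :: "(nat \<Rightarrow> real) \<Rightarrow> nnf \<Rightarrow> real" where
  "nnf_val v A = rterm_val v (nnf_interp A)"

lemma nnf_val_simps [simp]:
  "nnf_val v (Var x) = v x"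
  "nnf_val v (NVar x) = - v x"
  "nnf_val v Zero = 0"
  "nnf_val v (Add A B) = nnf_val v A + nnf_val v B"
  "nnf_val v (Scale r A) = real_of_preal r * nnf_val v A"
  "nnf_val v (Sup A B) = max (nnf_val v A) (nnf_val v B)"
  "nnf_val v (Inf A B) = min (nnf_val v A) (nnf_val v B)"
  by (simp_all add: nnf_val_def)

definition seq_val :: "(nat \<Rightarrow> real) \<Rightarrow> sequent \<Rightarrow> real" where
  "seq_val v \<Gamma> = (\<Sum>(r, A)\<in>#\<Gamma>. real_of_preal r * nnf_val v A)"

lemma seq_val_simps [simp]:
  "seq_val v {#} = 0"
  "seq_val v (add_mset (r, A) \<Gamma>) = real_of_preal r * nnf_val v A + seq_val v \<Gamma>"
  "seq_val v (\<Gamma> + \<Delta>) = seq_val v \<Gamma> + seq_val v \<Delta>"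
  by (simp_all add: seq_val_def)

lemma real_of_preal_pos [simp]: "0 < real_of_preal r"
  using real_of_preal[of r] by simp

lemma real_of_preal_times [simp]: "real_of_preal (r * s) = real_of_preal r * real_of_preal s"
  by (rule times_preal.rep_eq)

lemma seq_val_scale [simp]: "seq_val v (scale_seq s \<Gamma>) = real_of_preal s * seq_val v \<Gamma>"
  by (induction \<Gamma>) (auto simp: scale_seq_def algebra_simps)

lemma rterm_val_seq_interp: "rterm_val v (seq_interp \<Gamma>) = seq_val v \<Gamma>"
proof -
  obtain ws where ws: "mset ws = \<Gamma>"
    using ex_mset by blast
  have "rterm_val v (rsum (map wterm_interp us)) = seq_val v (mset us)" for us
    by (induction us) (auto simp: riesz_eq_sound[OF rsum_Cons] wterm_interp_def nnf_val_def)
  then show ?thesis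
    using riesz_eq_sound[OF seq_interp_eq[of ws]] by (simp add: ws)
qed

text \<open>In the totally ordered reals a finite nonempty join is nonnegative exactly when one of
  its members is. The empty hypersequent is invalid, although \<open>rsup []\<close> is
  \<open>RZero\<close>; hence \<open>G \<noteq> {#}\<close> below.\<close>

definition hseq_valid :: "hypersequent \<Rightarrow> bool" where
  "hseq_valid G \<longleftrightarrow> (\<forall>v. \<exists>\<Gamma>\<in>#G. 0 \<le> seq_val v \<Gamma>)"

lemma hseq_valid_if_riesz_le:
  assumes "G \<noteq> {#}" and "RZero \<le>\<^sub>R hseq_interp G"
  shows "hseq_valid G"
  unfolding hseq_valid_def
proof
  fix v
  obtain \<Gamma>s where \<Gamma>s: "mset \<Gamma>s = G" "hseq_interp G = rsup (map seq_interp \<Gamma>s)"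
    unfolding hseq_interp_def by (metis (mono_tags, lifting) ex_mset someI_ex)
  have "min 0 (rterm_val v (hseq_interp G)) = 0"
    using riesz_eq_sound[OF assms(2)[unfolded riesz_le_def]] by simp
  then have nonneg: "0 \<le> rterm_val v (rsup (map seq_interp \<Gamma>s))"
    using \<Gamma>s by (simp add: min_def split: if_splits)
  have "\<Delta>s \<noteq> [] \<Longrightarrow> 0 \<le> rterm_val v (rsup (map seq_interp \<Delta>s))
      \<Longrightarrow> \<exists>\<Gamma>\<in>set \<Delta>s. 0 \<le> seq_val v \<Gamma>" for \<Delta>s
  proof (induction \<Delta>s)
    case (Cons \<Gamma> \<Delta>s)
    then show ?case
      by (cases "\<Delta>s = []") (auto simp: rsup_Cons rterm_val_seq_interp le_max_iff_disj)
  qed simp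
  with nonneg \<Gamma>s(1) assms(1) show "\<exists>\<Gamma>\<in>#G. 0 \<le> seq_val v \<Gamma>"
    by (metis mset_zero_iff set_mset_mset)
qed

section \<open>Fourier-Motzkin elimination in the calculus\<close>

fun atom_coeff :: "nat \<Rightarrow> nnf \<Rightarrow> real" where
  "atom_coeff x (Var y) = (if y = x then 1 else 0)"
| "atom_coeff x (NVar y) = (if y = x then - 1 else 0)"
| "atom_coeff x _ = 0"

text \<open>For a sequent of atoms, the coefficient of \<open>x\<close> in the linear form
  \<open>seq_val\<close>. Compound terms contribute 0 by default.\<close>

definition coeff :: "nat \<Rightarrow> sequent \<Rightarrow> real" where
  "coeff x \<Gamma> = (\<Sum>(r, A)\<in>#\<Gamma>. real_of_preal r * atom_coeff x A)"

definition strip :: "nat \<Rightarrow> sequent \<Rightarrow> sequent" where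
  "strip x \<Gamma> = {#w \<in># \<Gamma>. snd w \<notin> {Var x, NVar x}#}"

definition atoms_over :: "nat set \<Rightarrow> nnf set" where
  "atoms_over V = Var ` V \<union> NVar ` V"

lemma coeff_simps [simp]:
  "coeff x {#} = 0"
  "coeff x (add_mset (r, A) \<Gamma>) = real_of_preal r * atom_coeff x A + coeff x \<Gamma>"
  "coeff x (\<Gamma> + \<Delta>) = coeff x \<Gamma> + coeff x \<Delta>"
  by (simp_all add: coeff_def)

lemma coeff_scale [simp]: "coeff x (scale_seq s \<Gamma>) = real_of_preal s * coeff x \<Gamma>"
  by (induction \<Gamma>) (auto simp: scale_seq_def algebra_simps)

lemma strip_simps [simp]:
  "strip x {#} = {#}"
  "strip x (add_mset (r, A) \<Gamma>) =
    (if A \<in> {Var x, NVar x} then strip x \<Gamma> else add_mset (r, A) (strip x \<Gamma>))"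
  by (simp_all add: strip_def)

text \<open>Isolates the dependence on \<open>x\<close>: atoms are linear in the valuation, and
  \<open>strip x \<Gamma>\<close> does not see the update at \<open>x\<close>.\<close>

lemma seq_val_strip:
  assumes "snd ` set_mset \<Gamma> \<subseteq> atoms_over V"
  shows "seq_val (v(x := t)) \<Gamma> = seq_val v (strip x \<Gamma>) + coeff x \<Gamma> * t"
  using assms by (induction \<Gamma>) (auto simp: atoms_over_def algebra_simps)

lemma atoms_strip:
  assumes "snd ` set_mset \<Gamma> \<subseteq> atoms_over (insert x V)"
  shows "snd ` set_mset (strip x \<Gamma>) \<subseteq> atoms_over V"
  using assms by (auto simp: strip_def atoms_over_def)

text \<open>Brings \<Gamma> into the shape of the conclusion of ID, whose side condition becomes
  \<open>coeff x \<Gamma> = 0\<close>.\<close>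

lemma strip_decomp:
  "\<exists>rs ss. \<Gamma> = strip x \<Gamma> + vec rs (Var x) + vec ss (NVar x) \<and> coeff x \<Gamma> = vec_sum rs - vec_sum ss"
proof (induction \<Gamma>)
  case empty
  show ?case by (rule exI[of _ "[]"], rule exI[of _ "[]"]) (simp add: vec_def vec_sum_def)
next
  case (add w \<Gamma>)
  obtain r A where w: "w = (r, A)" by force
  obtain rs ss where IH: "\<Gamma> = strip x \<Gamma> + vec rs (Var x) + vec ss (NVar x)"
      "coeff x \<Gamma> = vec_sum rs - vec_sum ss"
    using add.IH by blast
  consider "A = Var x" | "A = NVar x" | "A \<notin> {Var x, NVar x}" by blast
  then show ?case
  proof cases
    case 1
    with IH show ?thesis
      by (intro exI[of _ "r # rs"] exI[of _ ss]) (simp add: w vec_def vec_sum_def)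
  next
    case 2
    with IH show ?thesis
      by (intro exI[of _ rs] exI[of _ "r # ss"]) (simp add: w vec_def vec_sum_def)
  next
    case 3
    then have "atom_coeff x A = 0" by (cases A) auto
    with 3 IH show ?thesis
      by (intro exI[of _ rs] exI[of _ ss]) (simp add: w)
  qed
qed

lemma HR_unstrip:
  assumes "coeff x \<Gamma> = 0" and "HR (add_mset (strip x \<Gamma>) G)"
  shows "HR (add_mset \<Gamma> G)"
proof -
  obtain rs ss where "\<Gamma> = strip x \<Gamma> + vec rs (Var x) + vec ss (NVar x)"
      "coeff x \<Gamma> = vec_sum rs - vec_sum ss"
    using strip_decomp by blast
  with assms show ?thesis
    using HR_ID[of rs ss "strip x \<Gamma>" G x] by simp
qed

lemma HR_weaken: "HR G \<Longrightarrow> HR (G + H)"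
  by (induction H) (auto intro: HR_W)

lemma HR_contract:
  assumes "\<Gamma> \<in># G" and "HR (add_mset \<Gamma> G)"
  shows "HR G"
  using assms HR_C by (metis insert_DiffM)

text \<open>S separates the two summands, T undoes each scaling, and C absorbs the resulting copies
  of \<Gamma> and \<Delta> into \<open>G\<close>.\<close>

lemma HR_combine:
  assumes "\<Gamma> \<in># G" "\<Delta> \<in># G" and "HR (add_mset (scale_seq s \<Gamma> + scale_seq t \<Delta>) G)"
  shows "HR G"
proof -
  have "HR (add_mset \<Gamma> (add_mset (scale_seq t \<Delta>) G))"
    using HR_S[OF assms(3)] by (rule HR_T)
  then have "HR (add_mset (scale_seq t \<Delta>) G)"
    using HR_contract[of \<Gamma> "add_mset (scale_seq t \<Delta>) G"] assms(1) by simp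
  then have "HR (add_mset \<Delta> G)"
    by (rule HR_T)
  with assms(2) show ?thesis
    by (rule HR_contract)
qed

text \<open>Supplies the value of the eliminated variable from its lower and upper bounds. Empty
  sides are split off because \<open>Min\<close> and \<open>Max\<close> are meaningful only on
  nonempty sets.\<close>

lemma ex_between_finite:
  fixes L U :: "real set"
  assumes "finite L" "finite U" "\<And>l u. l \<in> L \<Longrightarrow> u \<in> U \<Longrightarrow> l < u"
  shows "\<exists>t. (\<forall>l\<in>L. l < t) \<and> (\<forall>u\<in>U. t < u)"
proof (cases "L = {}")
  case True
  have "Min U - 1 < u" if "u \<in> U" for u
    using Min_le[OF assms(2) that] by simp
  with True show ?thesis by blast
next
  case L: False
  show ?thesis
  proof (cases "U = {}")
    case True
    have "l < Max L + 1" if "l \<in> L" for l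
      using Max_ge[OF assms(1) that] by simp
    with True show ?thesis by blast
  next
    case False
    then have "Max L < Min U"
      using L assms by simp
    then obtain t where "Max L < t" "t < Min U"
      using dense by blast
    with L False assms(1,2) show ?thesis by auto
  qed
qed

text \<open>Induction on the variables. A valuation making every sequent of the eliminated system
  \<open>K\<close> negative could be changed at \<open>x\<close> to make all of \<open>G\<close>
  negative, so \<open>K\<close> inherits validity; its derivation is then extended to one of
  \<open>G\<close>.\<close>

lemma HR_atomic_complete:
  assumes "finite V" and "\<And>\<Gamma>. \<Gamma> \<in># G \<Longrightarrow> snd ` set_mset \<Gamma> \<subseteq> atoms_over V"
    and "hseq_valid G"
  shows "HR G"
  using assms
proof (induction V arbitrary: G rule: finite_induct)
  case empty
  \<comment> \<open>Validity provides a member of \<open>G\<close>; without variables it can only be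
    the empty sequent, so INIT and W suffice.\<close>
  obtain \<Gamma> where "\<Gamma> \<in># G"
    using empty.prems(2) unfolding hseq_valid_def by blast
  moreover have "\<Gamma> = {#}"
    using empty.prems(1)[OF \<open>\<Gamma> \<in># G\<close>] by (simp add: atoms_over_def)
  ultimately have "G = {#{#}#} + (G - {#{#}#})" by simp
  then show ?case
    using HR_weaken[OF HR_INIT] by metis
next
  case (insert x V)
  \<comment> \<open>Asking a sequent to be negative bounds the value of \<open>x\<close> from above
    on \<open>P\<close>, from below on \<open>N\<close>, and not at all on \<open>Z\<close>.\<close>
  define Z where "Z = {\<Gamma> \<in> set_mset G. coeff x \<Gamma> = 0}"
  define P where "P = {\<Gamma> \<in> set_mset G. coeff x \<Gamma> > 0}"
  define N where "N = {\<Gamma> \<in> set_mset G. coeff x \<Gamma> < 0}"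
  \<comment> \<open>Each sequent is weighted by the absolute coefficient of the other, so
    \<open>x\<close> cancels. For \<Gamma> in \<open>P\<close> and \<Delta> in \<open>N\<close> both
    weights are positive, as \<open>Abs_preal\<close> requires.\<close>
  define comb where "comb = (\<lambda>(\<Gamma>, \<Delta>). scale_seq (Abs_preal (- coeff x \<Delta>)) \<Gamma>
    + scale_seq (Abs_preal (coeff x \<Gamma>)) \<Delta>)"
  define K where "K = mset_set (strip x ` (Z \<union> comb ` (P \<times> N)))"
  have fin: "finite Z" "finite P" "finite N"
    by (auto simp: Z_def P_def N_def)
  have set_K: "set_mset K = strip x ` (Z \<union> comb ` (P \<times> N))"
    unfolding K_def using fin by simp
  have atoms: "snd ` set_mset \<Gamma> \<subseteq> atoms_over (insert x V)" if "\<Gamma> \<in> Z \<union> comb ` (P \<times> N)" for \<Gamma>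
  proof -
    have "snd ` set_mset (comb (\<Gamma>, \<Delta>)) = snd ` set_mset \<Gamma> \<union> snd ` set_mset \<Delta>" for \<Gamma> \<Delta>
      by (auto simp: comb_def scale_seq_def image_Un image_image case_prod_unfold)
    moreover have "snd ` set_mset \<Delta> \<subseteq> atoms_over (insert x V)" if "\<Delta> \<in> Z \<union> P \<union> N" for \<Delta>
      using that by (intro insert.prems(1)) (auto simp: Z_def P_def N_def)
    ultimately show ?thesis
      using that by (elim UnE imageE SigmaE) simp_all
  qed
  have preal: "real_of_preal (Abs_preal c) = c" if "c > 0" for c
    using that by (simp add: Abs_preal_inverse)
  have "hseq_valid K"
    unfolding hseq_valid_def
  proof (rule allI, rule ccontr)
    fix v
    assume "\<not> (\<exists>\<Gamma>\<in>#K. 0 \<le> seq_val v \<Gamma>)"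
    then have neg: "seq_val v (strip x \<Gamma>) < 0" if "\<Gamma> \<in> Z \<union> comb ` (P \<times> N)" for \<Gamma>
      using that unfolding set_K by (meson imageI not_less)
    \<comment> \<open>The value of \<open>x\<close> at which the linear form of \<Gamma> changes
      sign, for nonzero coefficient.\<close>
    define b where "b = (\<lambda>\<Gamma>. - seq_val v (strip x \<Gamma>) / coeff x \<Gamma>)"
    have "b \<Delta> < b \<Gamma>" if "\<Gamma> \<in> P" "\<Delta> \<in> N" for \<Gamma> \<Delta>
    proof -
      have c: "coeff x \<Gamma> > 0" "coeff x \<Delta> < 0"
        using that by (auto simp: P_def N_def)
      have "comb (\<Gamma>, \<Delta>) \<in> Z \<union> comb ` (P \<times> N)"
        using that by blast
      moreover have "seq_val v (strip x (comb (\<Gamma>, \<Delta>))) =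
          - coeff x \<Delta> * seq_val v (strip x \<Gamma>) + coeff x \<Gamma> * seq_val v (strip x \<Delta>)"
      proof -
        have "strip x (comb (\<Gamma>, \<Delta>)) = scale_seq (Abs_preal (- coeff x \<Delta>)) (strip x \<Gamma>)
            + scale_seq (Abs_preal (coeff x \<Gamma>)) (strip x \<Delta>)"
          by (simp add: comb_def strip_def scale_seq_def filter_mset_image_mset case_prod_unfold)
        with c show ?thesis by (simp add: preal)
      qed
      ultimately have "- coeff x \<Delta> * seq_val v (strip x \<Gamma>) + coeff x \<Gamma> * seq_val v (strip x \<Delta>) < 0"
        using neg by metis
      \<comment> \<open>Divide by the positive number
        \<open>- coeff x \<Gamma> * coeff x \<Delta>\<close>.\<close>
      with c show ?thesis
        by (simp add: b_def field_simps)
    qed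
    then have "\<exists>t. (\<forall>l\<in>b ` N. l < t) \<and> (\<forall>u\<in>b ` P. t < u)"
      using fin by (intro ex_between_finite) auto
    then obtain t where t: "\<And>\<Gamma>. \<Gamma> \<in> P \<Longrightarrow> t < b \<Gamma>" "\<And>\<Delta>. \<Delta> \<in> N \<Longrightarrow> b \<Delta> < t"
      by auto
    have "seq_val (v(x := t)) \<Gamma> < 0" if "\<Gamma> \<in># G" for \<Gamma>
    proof -
      have "seq_val v (strip x \<Gamma>) + coeff x \<Gamma> * t < 0"
      proof (cases "coeff x \<Gamma>" "0 :: real" rule: linorder_cases)
        case less
        then show ?thesis
          using t(2)[of \<Gamma>] that by (simp add: N_def b_def field_simps)
      next
        case equal
        then show ?thesis
          using neg[of \<Gamma>] that by (simp add: Z_def)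
      next
        case greater
        then show ?thesis
          using t(1)[of \<Gamma>] that by (simp add: P_def b_def field_simps)
      qed
      then show ?thesis
        using seq_val_strip[OF insert.prems(1)[OF that]] by simp
    qed
    then show False
      using insert.prems(2) unfolding hseq_valid_def by (meson not_less)
  qed
  moreover have "snd ` set_mset \<Gamma> \<subseteq> atoms_over V" if "\<Gamma> \<in># K" for \<Gamma>
    using that unfolding set_K by (elim imageE) (simp only: atoms atoms_strip)
  \<comment> \<open>\<open>G\<close> is added by weakening so that its sequents are present for the
    contractions that remove \<open>K\<close>.\<close>
  ultimately have "HR (K + G)"
    by (intro HR_weaken insert.IH)
  \<comment> \<open>One sequent of \<open>K\<close> is discharged at a time: ID restores
    \<open>x\<close>, giving a member of \<open>G\<close> or a combination of two, which C or
    \<open>HR_combine\<close> absorbs. \<open>J\<close> is the part of \<open>K\<close> still to be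
    discharged.\<close>
  have "HR (J + G)" if "\<Gamma> \<in># K" "HR (add_mset \<Gamma> (J + G))" for \<Gamma> J
  proof -
    have "\<Gamma> \<in> strip x ` (Z \<union> comb ` (P \<times> N))"
      using that(1) by (simp only: set_K)
    then obtain \<Gamma>' where \<Gamma>': "\<Gamma> = strip x \<Gamma>'" "\<Gamma>' \<in> Z \<union> comb ` (P \<times> N)"
      by (rule imageE)
    have "coeff x \<Gamma>' = 0"
      using \<Gamma>'(2) by (auto simp: Z_def P_def N_def comb_def preal)
    then have "HR (add_mset \<Gamma>' (J + G))"
      using that(2) unfolding \<Gamma>'(1) by (rule HR_unstrip)
    from \<Gamma>'(2) consider "\<Gamma>' \<in># G"
      | \<Gamma>\<^sub>1 \<Gamma>\<^sub>2 where "\<Gamma>\<^sub>1 \<in># G" "\<Gamma>\<^sub>2 \<in># G" "\<Gamma>' = comb (\<Gamma>\<^sub>1, \<Gamma>\<^sub>2)"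
      by (auto simp: Z_def P_def N_def)
    then show ?thesis
    proof cases
      case 1
      with \<open>HR (add_mset \<Gamma>' (J + G))\<close> show ?thesis
        by (intro HR_contract[of \<Gamma>' "J + G"]) simp_all
    next
      case 2
      with \<open>HR (add_mset \<Gamma>' (J + G))\<close> show ?thesis
        unfolding comb_def case_prod_conv by (intro HR_combine[of \<Gamma>\<^sub>1 "J + G" \<Gamma>\<^sub>2]) simp_all
    qed
  qed
  then have "set_mset J \<subseteq> set_mset K \<Longrightarrow> HR (J + G) \<Longrightarrow> HR G" for J
    by (induction J) auto
  from this[of K] \<open>HR (K + G)\<close> show ?case by simp
qed

section \<open>Reduction to the atomic case\<close>

text \<open>\<open>Zero\<close> has weight 1 so that its rule also decreases the measure; only atoms
  have weight 0.\<close>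

primrec complexity :: "nnf \<Rightarrow> nat" where
  "complexity (Var x) = 0"
| "complexity (NVar x) = 0"
| "complexity Zero = 1"
| "complexity (Add A B) = complexity A + complexity B + 1"
| "complexity (Scale r A) = complexity A + 1"
| "complexity (Sup A B) = complexity A + complexity B + 1"
| "complexity (Inf A B) = complexity A + complexity B + 1"

definition seq_complexity :: "sequent \<Rightarrow> nat" where
  "seq_complexity \<Gamma> = (\<Sum>w\<in>#\<Gamma>. complexity (snd w))"

text \<open>The base 3 absorbs the duplication of the context by the rule for joins.\<close>

definition hseq_measure :: "hypersequent \<Rightarrow> nat" where
  "hseq_measure G = (\<Sum>\<Gamma>\<in>#G. 3 ^ seq_complexity \<Gamma>)"

lemma seq_complexity_add [simp]:
  "seq_complexity (add_mset (r, A) \<Gamma>) = complexity A + seq_complexity \<Gamma>"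
  by (simp add: seq_complexity_def)

lemma hseq_measure_add [simp]: "hseq_measure (add_mset \<Gamma> G) = 3 ^ seq_complexity \<Gamma> + hseq_measure G"
  by (simp add: hseq_measure_def)

lemma hseq_valid_add [simp]:
  "hseq_valid (add_mset \<Gamma> G) \<longleftrightarrow> (\<forall>v. 0 \<le> seq_val v \<Gamma> \<or> (\<exists>\<Delta>\<in>#G. 0 \<le> seq_val v \<Delta>))"
  by (simp add: hseq_valid_def)

text \<open>Base 2 would lose strictness: two powers with exponent \<open>n - 1\<close> already add
  up to \<open>2 ^ n\<close>.\<close>

lemma power3_double_less: "a < n \<Longrightarrow> b < n \<Longrightarrow> (3::nat) ^ a + 3 ^ b < 3 ^ n"
proof (cases n)
  case (Suc m)
  assume "a < n" "b < n"
  then have "(3::nat) ^ a \<le> 3 ^ m" "(3::nat) ^ b \<le> 3 ^ m"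
    by (simp_all add: Suc power_increasing)
  moreover have "(0::nat) < 3 ^ m" by simp
  ultimately show ?thesis unfolding Suc power_Suc by linarith
qed simp

text \<open>Some non-atomic term is decomposed by its rule read upwards: the premises remain valid
  over the reals and have smaller measure.\<close>

lemma HR_complete:
  assumes "hseq_valid G"
  shows "HR G"
  using assms
proof (induction G rule: measure_induct_rule[of hseq_measure])
  case (less G)
  show ?case
  proof (cases "\<forall>\<Gamma>\<in>#G. snd ` set_mset \<Gamma> \<subseteq> atoms_over UNIV")
    case True
    \<comment> \<open>Elimination needs a finite set of variables, so those occurring in
      \<open>G\<close> are collected.\<close>
    define V where "V = {x. \<exists>\<Gamma>\<in>#G. \<exists>w\<in>#\<Gamma>. snd w \<in> {Var x, NVar x}}"
    have "finite {x. A \<in> {Var x, NVar x}}" for A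
      by (cases A) auto
    moreover have "V = (\<Union>\<Gamma>\<in>set_mset G. \<Union>w\<in>set_mset \<Gamma>. {x. snd w \<in> {Var x, NVar x}})"
      by (auto simp: V_def)
    ultimately have "finite V" by simp
    moreover have "snd ` set_mset \<Gamma> \<subseteq> atoms_over V" if "\<Gamma> \<in># G" for \<Gamma>
    proof
      fix A assume A: "A \<in> snd ` set_mset \<Gamma>"
      then have "A \<in> atoms_over UNIV" using True that by blast
      with A that show "A \<in> atoms_over V" by (fastforce simp: atoms_over_def V_def)
    qed
    ultimately show ?thesis
      using HR_atomic_complete less.prems by blast
  next
    case False
    then obtain \<Delta> r A where "\<Delta> \<in># G" "(r, A) \<in># \<Delta>" and A: "A \<notin> atoms_over UNIV"
      by force
    then obtain \<Gamma> H where G: "G = add_mset (add_mset (r, A) \<Gamma>) H"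
      by (metis mset_add)
    \<comment> \<open>Each rule is applied to one occurrence, with a vector of length 1.\<close>
    have single: "vec [s] B = {#(s, B)#}" for s B
      by (simp add: vec_def)
    show ?thesis
    proof (cases A)
      case Zero
      with less G have "HR (add_mset \<Gamma> H)"
        by simp
      then show ?thesis
        using HR_ZERO[of \<Gamma> H "[r]"] by (simp add: G Zero single)
    next
      case (Add B C)
      with less G have "HR (add_mset (add_mset (r, B) (add_mset (r, C) \<Gamma>)) H)"
        by (simp add: algebra_simps)
      then show ?thesis
        using HR_PLUS[of \<Gamma> "[r]" B C H] by (simp add: G Add single add_mset_commute)
    next
      case (Scale s B)
      with less G have "HR (add_mset (add_mset (s * r, B) \<Gamma>) H)"
        by (simp add: algebra_simps)
      then show ?thesis
        using HR_TIMES[of \<Gamma> s "[r]" B H] by (simp add: G Scale single)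
    next
      case (Sup B C)
      let ?G' = "add_mset (add_mset (r, B) \<Gamma>) (add_mset (add_mset (r, C) \<Gamma>) H)"
      \<comment> \<open>At each valuation the maximum equals one of its arguments, so one of the two
        new sequents has the value of the old one. Which one may depend on the valuation.\<close>
      have "hseq_valid ?G'"
        using less.prems by (auto simp: G Sup max_def split: if_splits)
      moreover have "hseq_measure ?G' < hseq_measure G"
        using power3_double_less[of "complexity B + seq_complexity \<Gamma>"
            "complexity B + complexity C + 1 + seq_complexity \<Gamma>" "complexity C + seq_complexity \<Gamma>"]
        by (simp add: G Sup)
      ultimately have "HR ?G'"
        by (intro less.IH)
      then show ?thesis
        using HR_SUP[of \<Gamma> "[r]" B C H] by (simp add: G Sup single)
    next
      case (Inf B C)
      \<comment> \<open>\<open>D\<close> treats both premises at once: replacing a meet by either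
        argument can only raise the value of the sequent.\<close>
      have "hseq_valid (add_mset (add_mset (r, D) \<Gamma>) H)" if "D \<in> {B, C}" for D
      proof -
        have "nnf_val v A \<le> nnf_val v D" for v
          using that by (auto simp: Inf)
        then have "real_of_preal r * nnf_val v A \<le> real_of_preal r * nnf_val v D" for v
          by simp
        then have "seq_val v (add_mset (r, A) \<Gamma>) \<le> seq_val v (add_mset (r, D) \<Gamma>)" for v
          by simp
        then show ?thesis
          using less.prems unfolding G hseq_valid_add by (meson order_trans)
      qed
      moreover have "hseq_measure (add_mset (add_mset (r, D) \<Gamma>) H) < hseq_measure G"
        if "D \<in> {B, C}" for D
      proof -
        have "complexity D < complexity A"
          using that by (auto simp: Inf)
        then show ?thesis by (simp add: G)
      qed
      ultimately have "HR (add_mset (add_mset (r, D) \<Gamma>) H)" if "D \<in> {B, C}" for D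
        using that less.IH by blast
      then show ?thesis
        using HR_INF[of \<Gamma> "[r]" B H C] by (simp add: G Inf single)
    qed (use A in \<open>auto simp: atoms_over_def\<close>)
  qed
qed

theorem theorem3p10:
  fixes G :: hypersequent
  assumes "G \<noteq> {#}"
    and "RZero \<le>\<^sub>R hseq_interp G"
  shows "HR G"
  using assms by (intro HR_complete hseq_valid_if_riesz_le)

end
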